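(* Let $A$ be a real $m\times n$ matrix, let $1\le s\le m$ be an integer, let $\{1,\dots,n\}$ be partitioned into disjoint sets $P_+$ and $P_n$, and let $\|\cdot\|$ be a norm on $\mathbb{R}^m$. Let $A$ satisfy the condition $\mathbf{VSG}_s(\xi,\theta,\rho,\sigma)$ with some $\xi\in[0,1)$, $\theta\in[1,\infty)$ and $\rho,\sigma\in[0,\infty)$. Then $A$ satisfies the condition $\mathbf{SG}_{s,\beta}(\xi,\theta)$ with $$\beta=\rho+\sigma\max_{k_+,k_n}\Big\{k_+(1+\theta\xi)+k_n(1+\xi):\ 0\le k_+\le\mathrm{Card}(P_+),\ 0\le k_n\le\mathrm{Card}(P_n),\ k_++k_n\le s\Big\}\le\rho+\sigma s(1+\theta\xi).$$ In particular, $A$ is $s$-semigood.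
   Context: Definitions (with respect to $s$, $P_+$, $P_n$ and the norm $\|\cdot\|$ on $\mathbb{R}^m$, whose conjugate norm is $\|z\|_*=\max\{z^Tx:\|x\|\le 1\}$). For $x\in\mathbb{R}^n$, $\|x\|_{s,1}$ is the sum of the $s$ largest magnitudes of entries of $x$. Given $\xi,\theta$, define $D_\theta[x]\in\mathbb{R}^n$ by $(D_\theta[x])_i=(1+\theta\xi)\max[x_i,0]$ for $i\in P_+$ and $(D_\theta[x])_i=(1+\xi)|x_i|$ for $i\notin P_+$, and set $\Phi_s(x)=\|D_\theta[x]\|_{s,1}$. Condition $\mathbf{VSG}_s(\xi,\theta,\rho,\sigma)$ on $A$: there exist an $m\times n$ matrix $Y=[y_1,\dots,y_n]$ and a vector $v\in\mathbb{R}^m$ such that, with $C_i[Y,A]$ denoting the $i$-th column of the matrix $I-Y^TA$, - $\Phi_s(-C_i[Y,A])+(A^Tv)_i\le\xi$ for $1\le i\le n$; - $\Phi_s(C_i[Y,A])-(A^Tv)_i\le\xi$ for $i\notin P_+$; - $\Phi_s(C_i[Y,A])-(A^Tv)_i\le\theta\xi$ for $i\in P_+$; - $\|y_i\|_*\le\sigma$ for $1\le i\le n$; - $\|v\|_*\le\rho$. Condition $\mathbf{SG}_{s,\beta}(\xi,\theta)$ on $A$: for every $x\in\mathbb{R}^n$ and every $J\subset\{1,\dots,n\}$ with $\mathrm{Card}(J)\le s$, $$\sum_{i\in J\cap P_+}x_i+\sum_{i\in J\cap P_n}|x_i|\le\beta\|Ax\|+\xi\Big(\sum_{i\in P_n\setminus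 J}|x_i|+\sum_{i\in P_+\setminus J}\max[-x_i,\theta x_i]\Big).$$ $A$ is $s$-semigood if for every $w\in\mathbb{R}^n$ with at most $s$ nonzero entries and $w_i\ge 0$ for all $i\in P_+$, $w$ is the unique optimal solution to $\min_z\{\|z\|_1: Az=Aw,\ z_i\ge 0\ \forall i\in P_+\}$. *)

theory Defs
  imports "HOL-Analysis.Analysis" "HOL-Library.Multiset"
begin

definition is_norm :: "('a::real_vector \<Rightarrow> real) \<Rightarrow> bool" where
  "is_norm N \<longleftrightarrow>
     (\<forall>x. 0 \<le> N x) \<and>
     (\<forall>x. N x = 0 \<longleftrightarrow> x = 0) \<and>
     (\<forall>c x. N (c *\<^sub>R x) = \<bar>c\<bar> * N x) \<and>
     (\<forall>x y. N (x + y) \<le> N x + N y)"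

(* For a norm N the unit ball is compact, so the supremum is an attained maximum;
   Sup is used because Max is only meaningful on finite sets. *)
definition conjugate_norm :: "(real^'m \<Rightarrow> real) \<Rightarrow> real^'m \<Rightarrow> real" where
  "conjugate_norm N z = Sup {z \<bullet> x | x. N x \<le> 1}"

definition l1_norm :: "real^'n \<Rightarrow> real" where
  "l1_norm x = (\<Sum>i\<in>UNIV. \<bar>x $ i\<bar>)"

(* The multiset of magnitudes is listed in decreasing order, with repetitions, and the first
   s terms are added; if s exceeds the dimension, all magnitudes are added. *)
definition s1_norm :: "nat \<Rightarrow> real^'n \<Rightarrow> real" where
  "s1_norm s x =
     sum_list (take s (rev (sorted_list_of_multiset (image_mset (\<lambda>i. \<bar>x $ i\<bar>) (mset_set UNIV)))))"

definition D_op :: "'n set \<Rightarrow> real \<Rightarrow> real \<Rightarrow> real^'n \<Rightarrow> real^'n" where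
  "D_op Pp \<xi> \<theta> x =
     (\<chi> i. if i \<in> Pp then (1 + \<theta> * \<xi>) * max (x $ i) 0 else (1 + \<xi>) * \<bar>x $ i\<bar>)"

definition Phi :: "'n::finite set \<Rightarrow> real \<Rightarrow> real \<Rightarrow> nat \<Rightarrow> real^'n \<Rightarrow> real" where
  "Phi Pp \<xi> \<theta> s x = s1_norm s (D_op Pp \<xi> \<theta> x)"

definition C_col :: "'n \<Rightarrow> real^'n^'m \<Rightarrow> real^'n^'m \<Rightarrow> real^'n" where
  "C_col i Y A = column i (mat 1 - transpose Y ** A)"

definition VSG ::
  "'n set \<Rightarrow> (real^'m \<Rightarrow> real) \<Rightarrow> nat \<Rightarrow> real \<Rightarrow> real \<Rightarrow> real \<Rightarrow> real \<Rightarrow> real^'n^'m \<Rightarrow> bool" where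
  "VSG Pp N s \<xi> \<theta> \<rho> \<sigma> A \<longleftrightarrow>
     (\<exists>(Y::real^'n^'m) (v::real^'m).
        (\<forall>i. Phi Pp \<xi> \<theta> s (- C_col i Y A) + (transpose A *v v) $ i \<le> \<xi>) \<and>
        (\<forall>i. i \<notin> Pp \<longrightarrow> Phi Pp \<xi> \<theta> s (C_col i Y A) - (transpose A *v v) $ i \<le> \<xi>) \<and>
        (\<forall>i\<in>Pp. Phi Pp \<xi> \<theta> s (C_col i Y A) - (transpose A *v v) $ i \<le> \<theta> * \<xi>) \<and>
        (\<forall>i. conjugate_norm N (column i Y) \<le> \<sigma>) \<and>
        conjugate_norm N v \<le> \<rho>)"

definition SG ::
  "'n set \<Rightarrow> 'n set \<Rightarrow> (real^'m \<Rightarrow> real) \<Rightarrow> nat \<Rightarrow> real \<Rightarrow> real \<Rightarrow> real \<Rightarrow> real^'n^'m \<Rightarrow> bool" where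
  "SG Pp Pn N s \<beta> \<xi> \<theta> A \<longleftrightarrow>
     (\<forall>x J. card J \<le> s \<longrightarrow>
        (\<Sum>i\<in>J \<inter> Pp. x $ i) + (\<Sum>i\<in>J \<inter> Pn. \<bar>x $ i\<bar>)
        \<le> \<beta> * N (A *v x)
          + \<xi> * ((\<Sum>i\<in>Pn - J. \<bar>x $ i\<bar>) + (\<Sum>i\<in>Pp - J. max (- (x $ i)) (\<theta> * x $ i))))"

definition semigood :: "'n set \<Rightarrow> nat \<Rightarrow> real^'n^'m \<Rightarrow> bool" where
  "semigood Pp s A \<longleftrightarrow>
     (\<forall>w. card {i. w $ i \<noteq> 0} \<le> s \<and> (\<forall>i\<in>Pp. 0 \<le> w $ i) \<longrightarrow>
        (\<forall>z. is_arg_min l1_norm (\<lambda>z. A *v z = A *v w \<and> (\<forall>i\<in>Pp. 0 \<le> z $ i)) z \<longleftrightarrow> z = w))"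

end

theory Submission
  imports Defs
begin

text \<open>
  Fix a set \<open>J\<close> of at most \<open>s\<close> indices and let \<open>g x\<close> be the sum over \<open>J\<close> of the entries of
  \<open>D_op Pp \<xi> \<theta> x\<close>.  The functional \<open>g\<close> is sublinear and is bounded above by \<open>Phi\<close>.  Adding
  \<open>\<xi>\<close> times the penalty carried by \<open>J\<close> to both sides of the inequality in \<open>SG\<close> extends the
  penalty on the right to all indices; the left side then becomes at most \<open>g x\<close>.  So it suffices to
  bound \<open>g x\<close> by \<open>\<beta> * N (A *v x)\<close> plus \<open>\<xi>\<close> times the penalty of the whole vector \<open>x\<close>.

  To do so, write \<open>x = (I - Y\<^sup>T A) x + Y\<^sup>T A x\<close>, where the first summand is the combination of the
  columns \<open>C_col i Y A\<close> with coefficients \<open>x $ i\<close>.  By sublinearity column \<open>i\<close> contributes at most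
  \<open>\<bar>x $ i\<bar>\<close> times \<open>Phi\<close> of the column or of its negative, according to the sign of \<open>x $ i\<close>,
  and the first three conditions in \<open>VSG\<close> turn this into the penalty of that entry plus
  \<open>x $ i * (A\<^sup>T v) $ i\<close>.  The latter terms add up to \<open>v \<bullet> (A *v x) \<le> \<rho> * N (A *v x)\<close>.  Every entry
  of \<open>Y\<^sup>T A x\<close> is at most \<open>\<sigma> * N (A *v x)\<close> in magnitude, which yields the factor of \<open>\<sigma>\<close> in
  \<open>\<beta>\<close>, with \<open>J\<close> contributing its numbers of indices from \<open>Pp\<close> and from \<open>Pn\<close>.

  For semigoodness, let \<open>z\<close> compete with the sparse \<open>w\<close>.  The \<open>SG\<close> inequality for \<open>w - z\<close> on the
  support of \<open>w\<close> forces \<open>z\<close> to vanish off that support unless its norm is larger; a kernel vector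
  supported on at most \<open>s\<close> indices is then shown to vanish, by comparing its positive and negative
  parts with each other.
\<close>

section \<open>Norms and their conjugates\<close>

lemma is_norm_zero:
  assumes "is_norm N"
  shows "N 0 = 0"
  using assms by (simp add: is_norm_def)

text \<open>A norm is convex, hence continuous in finite dimension, so it attains a positive minimum on
  the Euclidean unit sphere.\<close>

lemma is_norm_ge_scaled_norm:
  fixes N :: "'a::euclidean_space \<Rightarrow> real"
  assumes "is_norm N"
  obtains c where "0 < c" "\<And>x. c * norm x \<le> N x"
proof -
  have nn: "\<And>x. 0 \<le> N x" and z: "\<And>x. N x = 0 \<longleftrightarrow> x = 0"
    and sc: "\<And>c x. N (c *\<^sub>R x) = \<bar>c\<bar> * N x" and tri: "\<And>x y. N (x + y) \<le> N x + N y"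
    using assms by (auto simp: is_norm_def)
  have "convex_on UNIV N"
  proof (rule convex_onI)
    fix t :: real and x y :: 'a assume "0 < t" "t < 1"
    then show "N ((1 - t) *\<^sub>R x + t *\<^sub>R y) \<le> (1 - t) * N x + t * N y"
      using tri[of "(1 - t) *\<^sub>R x" "t *\<^sub>R y"] by (simp add: sc)
  qed simp
  then have "continuous_on UNIV N"
    by (rule convex_on_continuous[OF open_UNIV])
  then have "continuous_on (sphere 0 1) N"
    by (rule continuous_on_subset) simp
  moreover have "sphere (0::'a) 1 \<noteq> {}"
    by simp
  ultimately obtain u where u: "u \<in> sphere 0 1" "\<And>y. y \<in> sphere 0 1 \<Longrightarrow> N u \<le> N y"
    using continuous_attains_inf[OF compact_sphere] by blast
  have "N u * norm x \<le> N x" for x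
  proof (cases "x = 0")
    case False
    have "N u \<le> N ((1 / norm x) *\<^sub>R x)"
      using False by (intro u(2)) simp
    then show ?thesis
      using False by (simp add: sc field_simps)
  qed (simp add: nn)
  moreover have "u \<noteq> 0"
    using u(1) by auto
  then have "0 < N u"
    using nn[of u] z[of u] by linarith
  ultimately show thesis
    using that by blast
qed

text \<open>The lower bound by the Euclidean norm makes the set in the definition of the conjugate norm
  bounded above, so its supremum dominates its elements; general \<open>x\<close> follow by scaling.\<close>

lemma inner_le_conjugate_norm:
  assumes "is_norm N"
  shows "z \<bullet> x \<le> conjugate_norm N z * N x"
proof (cases "x = 0")
  case False
  have nn: "\<And>x. 0 \<le> N x" and z: "\<And>x. N x = 0 \<longleftrightarrow> x = 0"
    and sc: "\<And>c x. N (c *\<^sub>R x) = \<bar>c\<bar> * N x"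
    using assms by (auto simp: is_norm_def)
  obtain c where c: "0 < c" "\<And>x. c * norm x \<le> N x"
    using is_norm_ge_scaled_norm[OF assms] by metis
  have "z \<bullet> y \<le> norm z / c" if "N y \<le> 1" for y
  proof -
    have "norm y \<le> 1 / c"
      using c(2)[of y] that c(1) by (simp add: field_simps)
    then have "norm z * norm y \<le> norm z * (1 / c)"
      by (intro mult_left_mono) auto
    then show ?thesis
      using norm_cauchy_schwarz[of z y] by simp
  qed
  then have "bdd_above {z \<bullet> y | y. N y \<le> 1}"
    by (auto intro!: bdd_aboveI)
  moreover have pos: "0 < N x"
    using nn[of x] z[of x] False by linarith
  moreover have "N ((1 / N x) *\<^sub>R x) \<le> 1"
    using pos by (simp add: sc)
  ultimately have "z \<bullet> ((1 / N x) *\<^sub>R x) \<le> conjugate_norm N z"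
    unfolding conjugate_norm_def by (intro cSup_upper) blast+
  then show ?thesis
    using pos by (simp add: field_simps)
qed (simp add: is_norm_zero[OF assms])

lemma abs_inner_le_conjugate_norm:
  assumes "is_norm N"
  shows "\<bar>z \<bullet> x\<bar> \<le> conjugate_norm N z * N x"
proof -
  have "N (- x) = N x"
    using assms unfolding is_norm_def by (metis abs_minus_cancel abs_one mult_1 scaleR_minus1_left)
  then show ?thesis
    using inner_le_conjugate_norm[OF assms, of z x] inner_le_conjugate_norm[OF assms, of z "- x"]
    by (simp add: abs_le_iff)
qed

section \<open>Sums of largest magnitudes\<close>

text \<open>Greedy exchange: at each step the head of the list is removed together with some element of
  \<open>M\<close>, namely the head itself if \<open>M\<close> contains it, and otherwise any element, which is no larger.\<close>

lemma sum_mset_le_sum_list_take: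
  fixes xs :: "real list"
  assumes "sorted_wrt (\<ge>) xs" "\<And>x. x \<in> set xs \<Longrightarrow> 0 \<le> x" "M \<subseteq># mset xs" "size M \<le> s"
  shows "sum_mset M \<le> sum_list (take s xs)"
  using assms
proof (induction xs arbitrary: M s)
  case Nil
  then show ?case by simp
next
  case (Cons a xs)
  show ?case
  proof (cases "M = {#}")
    case True
    have "0 \<le> sum_list (take s (a # xs))"
      by (rule sum_list_nonneg) (metis Cons.prems(2) in_set_takeD)
    then show ?thesis
      using True by simp
  next
    case False
    then obtain k where k: "s = Suc k"
      using Cons.prems(4) by (cases s) auto
    have sub: "M - {#a#} \<subseteq># mset xs"
      using Cons.prems(3) by (simp add: subset_eq_diff_conv)
    obtain b where b: "b \<in># M" "b \<le> a" "M - {#b#} \<subseteq># mset xs"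
    proof (cases "a \<in># M")
      case True
      with sub that show thesis by blast
    next
      case notin: False
      obtain b where "b \<in># M"
        using False by blast
      moreover have "M \<subseteq># mset xs"
        using sub notin by (simp add: diff_single_trivial)
      moreover from calculation have "b \<in> set xs"
        by (metis in_multiset_in_set mset_subset_eqD)
      then have "b \<le> a"
        using Cons.prems(1) by simp
      ultimately show thesis
        using that by (meson diff_subset_eq_self subset_mset.order_trans)
    qed
    have "sum_mset (M - {#b#}) \<le> sum_list (take k xs)"
      using Cons.prems b k by (intro Cons.IH) (auto simp: size_Diff_singleton)
    moreover have "sum_mset M = b + sum_mset (M - {#b#})"
      using b(1) by (metis insert_DiffM sum_mset.add_mset)
    ultimately show ?thesis
      using b(2) k by simp
  qed
qed

lemma sum_abs_le_s1_norm:
  fixes x :: "real^'n"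
  assumes "card J \<le> s"
  shows "(\<Sum>i\<in>J. \<bar>x $ i\<bar>) \<le> s1_norm s x"
proof -
  let ?M = "\<lambda>K. image_mset (\<lambda>i. \<bar>x $ i\<bar>) (mset_set K)"
  let ?xs = "rev (sorted_list_of_multiset (?M UNIV))"
  have "(\<Sum>i\<in>J. \<bar>x $ i\<bar>) = sum_mset (?M J)"
    by (simp add: sum_unfold_sum_mset)
  also have "\<dots> \<le> sum_list (take s ?xs)"
  proof (rule sum_mset_le_sum_list_take)
    show "sorted_wrt (\<ge>) ?xs"
      by (simp add: sorted_wrt_rev)
    show "?M J \<subseteq># mset ?xs"
      by (simp add: image_mset_subseteq_mono subset_imp_msubset_mset_set)
  qed (use assms in auto)
  finally show ?thesis
    by (simp add: s1_norm_def)
qed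

section \<open>The weighting operator\<close>

lemma D_op_nonneg:
  assumes "0 \<le> \<xi>" "0 \<le> \<theta>"
  shows "0 \<le> D_op Pp \<xi> \<theta> x $ k"
  using assms by (simp add: D_op_def)

lemma sum_D_op_le_Phi:
  assumes "0 \<le> \<xi>" "0 \<le> \<theta>" "card J \<le> s"
  shows "(\<Sum>k\<in>J. D_op Pp \<xi> \<theta> x $ k) \<le> Phi Pp \<xi> \<theta> s x"
  using sum_abs_le_s1_norm[OF assms(3), of "D_op Pp \<xi> \<theta> x"]
  by (simp add: Phi_def D_op_nonneg[OF assms(1,2)])

lemma D_op_add_le:
  assumes "0 \<le> \<xi>" "0 \<le> \<theta>"
  shows "D_op Pp \<xi> \<theta> (x + y) $ k \<le> D_op Pp \<xi> \<theta> x $ k + D_op Pp \<xi> \<theta> y $ k"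
proof -
  have "(1 + \<theta> * \<xi>) * max (x $ k + y $ k) 0 \<le> (1 + \<theta> * \<xi>) * (max (x $ k) 0 + max (y $ k) 0)"
    using assms by (intro mult_left_mono) auto
  moreover have "(1 + \<xi>) * \<bar>x $ k + y $ k\<bar> \<le> (1 + \<xi>) * (\<bar>x $ k\<bar> + \<bar>y $ k\<bar>)"
    using assms by (intro mult_left_mono) auto
  ultimately show ?thesis
    by (simp add: D_op_def distrib_left)
qed

lemma D_op_sum_le:
  assumes "0 \<le> \<xi>" "0 \<le> \<theta>"
  shows "D_op Pp \<xi> \<theta> (\<Sum>i\<in>I. f i) $ k \<le> (\<Sum>i\<in>I. D_op Pp \<xi> \<theta> (f i) $ k)"
proof (induction I rule: infinite_finite_induct)
  case (insert i I)
  then show ?case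
    using D_op_add_le[OF assms, of Pp "f i" "\<Sum>i\<in>I. f i" k] by simp
qed (simp_all add: D_op_def)

lemma D_op_scaleR:
  assumes "0 \<le> c"
  shows "D_op Pp \<xi> \<theta> (c *\<^sub>R x) = c *\<^sub>R D_op Pp \<xi> \<theta> x"
proof -
  have "max (c * t) 0 = c * max t 0" for t
    using assms by (simp add: max_mult_distrib_left)
  then show ?thesis
    using assms by (simp add: D_op_def vec_eq_iff abs_mult)
qed

section \<open>The semigoodness inequality\<close>

text \<open>Expanding \<open>(I - Y\<^sup>T A) x\<close> along columns makes the individual columns, which are what \<open>VSG\<close>
  controls, appear as summands of \<open>x\<close>.\<close>

lemma decompose_along_C_col:
  fixes A Y :: "real^'n^'m"
  shows "x = (\<Sum>i\<in>UNIV. x $ i *\<^sub>R C_col i Y A) + transpose Y *v (A *v x)"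
proof -
  have "(\<Sum>i\<in>UNIV. x $ i *\<^sub>R C_col i Y A) = (mat 1 - transpose Y ** A) *v x"
    by (simp add: C_col_def matrix_mult_sum scalar_mult_eq_scaleR)
  then show ?thesis
    by (simp add: matrix_vector_mult_diff_rdistrib matrix_vector_mul_assoc)
qed

text \<open>The maximum over the set below is the largest total weight of at most \<open>s\<close> indices, those of
  one kind weighing \<open>a\<close> and those of the other \<open>b\<close>; it becomes the coefficient of \<open>\<sigma>\<close> in
  \<open>\<beta>\<close>.\<close>

lemma finite_index_weights:
  "finite {real kp * a + real kn * b | kp kn. kp \<le> p \<and> kn \<le> q \<and> kp + kn \<le> s}"
proof (rule finite_subset)
  show "{real kp * a + real kn * b | kp kn. kp \<le> p \<and> kn \<le> q \<and> kp + kn \<le> s}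
      \<subseteq> (\<lambda>(kp, kn). real kp * a + real kn * b) ` ({..p} \<times> {..q})"
    by auto
qed simp

lemma Max_index_weights_le:
  assumes "0 \<le> b" "b \<le> a"
  shows "Max {real kp * a + real kn * b | kp kn. kp \<le> p \<and> kn \<le> q \<and> kp + kn \<le> s} \<le> real s * a"
proof -
  have "real kp * a + real kn * b \<le> real s * a" if "kp + kn \<le> s" for kp kn :: nat
  proof -
    have "real kn * b \<le> real kn * a"
      using assms by (intro mult_left_mono) auto
    moreover have "real (kp + kn) * a \<le> real s * a"
      using assms that by (intro mult_right_mono) linarith+
    ultimately show ?thesis
      by (simp add: distrib_right)
  qed
  moreover have "{real kp * a + real kn * b | kp kn. kp \<le> p \<and> kn \<le> q \<and> kp + kn \<le> s} \<noteq> {}"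
    by (auto intro!: exI[of _ 0])
  ultimately show ?thesis
    using finite_index_weights by (subst Max_le_iff) auto
qed

text \<open>An entry of \<open>x\<close> bounded by \<open>t\<close> in magnitude is scaled by \<open>D_op\<close> to at most its weight
  times \<open>t\<close>, so the indices in \<open>J\<close> contribute at most their total weight times \<open>t\<close>.\<close>

lemma sum_D_op_le_Max_index_weights:
  fixes x :: "real^'n"
  assumes "0 \<le> \<xi>" "0 \<le> \<theta>" "card J \<le> s" "Pp \<union> Pn = UNIV" "Pp \<inter> Pn = {}" "\<And>k. \<bar>x $ k\<bar> \<le> t"
  shows "(\<Sum>k\<in>J. D_op Pp \<xi> \<theta> x $ k)
    \<le> t * Max {real kp * (1 + \<theta> * \<xi>) + real kn * (1 + \<xi>) | kp kn.
                 kp \<le> card Pp \<and> kn \<le> card Pn \<and> kp + kn \<le> s}" (is "_ \<le> t * Max ?W")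
proof -
  have t: "0 \<le> t"
    using assms(6) by (metis abs_ge_zero order_trans)
  have D: "D_op Pp \<xi> \<theta> x $ k \<le> (if k \<in> Pp then 1 + \<theta> * \<xi> else 1 + \<xi>) * t" for k
  proof -
    have "max (x $ k) 0 \<le> t"
      using assms(6)[of k] by linarith
    then show ?thesis
      using assms(1,2,6) by (auto simp: D_op_def intro!: mult_left_mono)
  qed
  have "(\<Sum>k\<in>J. D_op Pp \<xi> \<theta> x $ k) \<le> (\<Sum>k\<in>J. (if k \<in> Pp then 1 + \<theta> * \<xi> else 1 + \<xi>) * t)"
    by (intro sum_mono D)
  also have "\<dots> = t * (\<Sum>k\<in>J. if k \<in> Pp then 1 + \<theta> * \<xi> else 1 + \<xi>)"
    by (simp add: sum_distrib_left mult.commute)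
  also have "(\<Sum>k\<in>J. if k \<in> Pp then 1 + \<theta> * \<xi> else 1 + \<xi>)
      = real (card (J \<inter> Pp)) * (1 + \<theta> * \<xi>) + real (card (J - Pp)) * (1 + \<xi>)"
    by (simp add: sum.If_cases Diff_eq)
  also have "t * \<dots> \<le> t * Max ?W"
  proof (intro mult_left_mono[OF _ t] Max_ge[OF finite_index_weights])
    have "card (J - Pp) \<le> card Pn"
      using assms(4) by (intro card_mono) auto
    moreover have "card (J \<inter> Pp) + card (J - Pp) = card J"
      by (simp add: card_Int_Diff[of J Pp])
    ultimately show "real (card (J \<inter> Pp)) * (1 + \<theta> * \<xi>) + real (card (J - Pp)) * (1 + \<xi>) \<in> ?W"
      using assms(3) by (intro CollectI exI conjI refl) (auto intro: card_mono)
  qed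
  finally show ?thesis .
qed

text \<open>The sublinear estimate at the heart of the argument: the penalty on the right runs over all
  indices, so that \<open>J\<close> enters only through the functional on the left.\<close>

lemma VSG_sum_D_op_le:
  fixes A :: "real^'n^'m"
  assumes "is_norm N" "0 \<le> \<xi>" "0 \<le> \<theta>" "VSG Pp N s \<xi> \<theta> \<rho> \<sigma> A"
    "Pp \<union> Pn = UNIV" "Pp \<inter> Pn = {}" "card J \<le> s"
  shows "(\<Sum>k\<in>J. D_op Pp \<xi> \<theta> x $ k)
    \<le> (\<rho> + \<sigma> * Max {real kp * (1 + \<theta> * \<xi>) + real kn * (1 + \<xi>) | kp kn.
                        kp \<le> card Pp \<and> kn \<le> card Pn \<and> kp + kn \<le> s}) * N (A *v x)
      + \<xi> * (\<Sum>i\<in>UNIV. if i \<in> Pp then max (- (x $ i)) (\<theta> * x $ i) else \<bar>x $ i\<bar>)"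
    (is "_ \<le> (\<rho> + \<sigma> * ?W) * _ + \<xi> * (\<Sum>i\<in>UNIV. ?pen i)")
proof -
  obtain Y :: "real^'n^'m" and v :: "real^'m" where
      neg: "\<And>i. Phi Pp \<xi> \<theta> s (- C_col i Y A) + (transpose A *v v) $ i \<le> \<xi>"
    and pos_n: "\<And>i. i \<notin> Pp \<Longrightarrow> Phi Pp \<xi> \<theta> s (C_col i Y A) - (transpose A *v v) $ i \<le> \<xi>"
    and pos_p: "\<And>i. i \<in> Pp \<Longrightarrow> Phi Pp \<xi> \<theta> s (C_col i Y A) - (transpose A *v v) $ i \<le> \<theta> * \<xi>"
    and Y: "\<And>i. conjugate_norm N (column i Y) \<le> \<sigma>"
    and v: "conjugate_norm N v \<le> \<rho>"
    using assms(4) unfolding VSG_def by blast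
  define g where "g = (\<lambda>y. \<Sum>k\<in>J. D_op Pp \<xi> \<theta> y $ k)"
  let ?c = "\<lambda>i. C_col i Y A" and ?a = "\<lambda>i. (transpose A *v v) $ i"
  have Nx: "0 \<le> N (A *v x)"
    using assms(1) by (simp add: is_norm_def)
  have g_scale: "g (c *\<^sub>R y) = c * g y" if "0 \<le> c" for c y
    using that by (simp add: g_def D_op_scaleR sum_distrib_left)
  have g_Phi: "g y \<le> Phi Pp \<xi> \<theta> s y" for y
    unfolding g_def using assms by (intro sum_D_op_le_Phi) auto
  have col: "g (x $ i *\<^sub>R ?c i) \<le> x $ i * ?a i + \<xi> * ?pen i" for i
  proof (cases "0 \<le> x $ i")
    case True
    have "g (x $ i *\<^sub>R ?c i) \<le> x $ i * (?a i + (if i \<in> Pp then \<theta> * \<xi> else \<xi>))"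
      using True g_Phi[of "?c i"] pos_n[of i] pos_p[of i]
      by (subst g_scale) (auto intro!: mult_left_mono)
    moreover have "i \<in> Pp \<Longrightarrow> \<theta> * x $ i \<le> ?pen i" "i \<notin> Pp \<Longrightarrow> x $ i \<le> ?pen i"
      by auto
    then have "\<xi> * (if i \<in> Pp then \<theta> * x $ i else x $ i) \<le> \<xi> * ?pen i"
      using assms(2) by (intro mult_left_mono) auto
    ultimately show ?thesis
      by (auto simp: algebra_simps split: if_splits)
  next
    case False
    have "g (x $ i *\<^sub>R ?c i) = g ((- x $ i) *\<^sub>R (- ?c i))"
      by simp
    also have "\<dots> = (- x $ i) * g (- ?c i)"
      using False by (intro g_scale) simp
    also have "\<dots> \<le> (- x $ i) * (\<xi> - ?a i)"
      using False g_Phi[of "- ?c i"] neg[of i] by (intro mult_left_mono) auto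
    finally have "g (x $ i *\<^sub>R ?c i) \<le> x $ i * ?a i + \<xi> * (- x $ i)"
      by (simp add: algebra_simps)
    moreover have "\<xi> * (- x $ i) \<le> \<xi> * ?pen i"
      using assms(2) by (intro mult_left_mono) auto
    ultimately show ?thesis
      by linarith
  qed
  have "g x = g ((\<Sum>i\<in>UNIV. x $ i *\<^sub>R ?c i) + transpose Y *v (A *v x))"
    using decompose_along_C_col[of x Y A] by simp
  also have "\<dots> \<le> g (\<Sum>i\<in>UNIV. x $ i *\<^sub>R ?c i) + g (transpose Y *v (A *v x))"
    unfolding g_def sum.distrib[symmetric] by (intro sum_mono D_op_add_le assms)
  also have "g (\<Sum>i\<in>UNIV. x $ i *\<^sub>R ?c i) \<le> (\<Sum>i\<in>UNIV. g (x $ i *\<^sub>R ?c i))"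
    unfolding g_def by (subst sum.swap) (intro sum_mono D_op_sum_le assms)
  also have "\<dots> \<le> (\<Sum>i\<in>UNIV. x $ i * ?a i + \<xi> * ?pen i)"
    by (intro sum_mono col)
  also have "\<dots> = v \<bullet> (A *v x) + \<xi> * (\<Sum>i\<in>UNIV. ?pen i)"
  proof -
    have "(\<Sum>i\<in>UNIV. x $ i * ?a i) = x \<bullet> (transpose A *v v)"
      by (simp add: inner_vec_def)
    also have "\<dots> = v \<bullet> (A *v x)"
      by (metis dot_lmul_matrix inner_commute transpose_matrix_vector)
    finally show ?thesis
      by (simp add: sum.distrib sum_distrib_left)
  qed
  also have "v \<bullet> (A *v x) \<le> \<rho> * N (A *v x)"
    using inner_le_conjugate_norm[OF assms(1)] mult_right_mono[OF v Nx] by (rule order_trans)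
  also have "g (transpose Y *v (A *v x)) \<le> \<sigma> * N (A *v x) * ?W"
    unfolding g_def
  proof (rule sum_D_op_le_Max_index_weights)
    fix k
    have "(transpose Y *v (A *v x)) $ k = column k Y \<bullet> (A *v x)"
      by (simp add: matrix_vector_mult_def transpose_def column_def inner_vec_def)
    then show "\<bar>(transpose Y *v (A *v x)) $ k\<bar> \<le> \<sigma> * N (A *v x)"
      using abs_inner_le_conjugate_norm[OF assms(1), of "column k Y" "A *v x"]
        mult_right_mono[OF Y[of k] Nx] by simp
  qed (use assms in auto)
  finally show ?thesis
    by (simp add: g_def algebra_simps)
qed

text \<open>On \<open>J\<close> an entry plus \<open>\<xi>\<close> times its penalty is at most the corresponding entry of \<open>D_op\<close>;
  this is where \<open>\<xi> \<le> 1\<close> enters, for negative entries in \<open>Pp\<close>.\<close>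

lemma VSG_imp_SG:
  fixes A :: "real^'n^'m"
  assumes "is_norm N" "0 \<le> \<xi>" "\<xi> \<le> 1" "0 \<le> \<theta>" "VSG Pp N s \<xi> \<theta> \<rho> \<sigma> A"
    "Pp \<union> Pn = UNIV" "Pp \<inter> Pn = {}"
  shows "SG Pp Pn N s (\<rho> + \<sigma> * Max {real kp * (1 + \<theta> * \<xi>) + real kn * (1 + \<xi>) | kp kn.
                kp \<le> card Pp \<and> kn \<le> card Pn \<and> kp + kn \<le> s}) \<xi> \<theta> A" (is "SG _ _ _ _ ?\<beta> _ _ _")
  unfolding SG_def
proof (intro allI impI)
  fix x :: "real^'n" and J :: "'n set"
  assume J: "card J \<le> s"
  let ?pen = "\<lambda>i. if i \<in> Pp then max (- (x $ i)) (\<theta> * x $ i) else \<bar>x $ i\<bar>"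
  let ?val = "\<lambda>i. if i \<in> Pp then x $ i else \<bar>x $ i\<bar>"
  have Pn: "Pn = - Pp"
    using assms(6,7) by blast
  have "?val k + \<xi> * ?pen k \<le> D_op Pp \<xi> \<theta> x $ k" for k
  proof -
    have "x $ k + \<xi> * max (- (x $ k)) (\<theta> * x $ k) \<le> (1 + \<theta> * \<xi>) * max (x $ k) 0"
    proof (cases "0 \<le> x $ k")
      case True
      then have "max (- (x $ k)) (\<theta> * x $ k) = \<theta> * x $ k"
        using mult_nonneg_nonneg[OF assms(4) True] by linarith
      then show ?thesis
        using True by (simp add: algebra_simps)
    next
      case False
      then have "max (- (x $ k)) (\<theta> * x $ k) = - (x $ k)"
        using mult_nonneg_nonpos[of \<theta> "x $ k"] assms(4) by linarith
      then show ?thesis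
        using False assms(3) mult_right_mono[of \<xi> 1 "- (x $ k)"] by simp
    qed
    then show ?thesis
      by (auto simp: D_op_def algebra_simps)
  qed
  then have "(\<Sum>k\<in>J. ?val k + \<xi> * ?pen k) \<le> (\<Sum>k\<in>J. D_op Pp \<xi> \<theta> x $ k)"
    by (rule sum_mono)
  also have "\<dots> \<le> ?\<beta> * N (A *v x) + \<xi> * (\<Sum>i\<in>UNIV. ?pen i)"
    using assms J by (intro VSG_sum_D_op_le) auto
  also have "(\<Sum>i\<in>UNIV. ?pen i) = (\<Sum>i\<in>J. ?pen i) + (\<Sum>i\<in>-J. ?pen i)"
    by (simp add: sum.subset_diff[of J UNIV] Compl_eq_Diff_UNIV)
  finally have "(\<Sum>k\<in>J. ?val k) \<le> ?\<beta> * N (A *v x) + \<xi> * (\<Sum>i\<in>-J. ?pen i)"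
    by (simp add: sum.distrib sum_distrib_left distrib_left)
  moreover have "(\<Sum>k\<in>J. ?val k) = (\<Sum>i\<in>J \<inter> Pp. x $ i) + (\<Sum>i\<in>J \<inter> Pn. \<bar>x $ i\<bar>)"
    by (simp add: sum.If_cases Pn)
  moreover have "(\<Sum>i\<in>-J. ?pen i)
      = (\<Sum>i\<in>Pn - J. \<bar>x $ i\<bar>) + (\<Sum>i\<in>Pp - J. max (- (x $ i)) (\<theta> * x $ i))"
    by (simp add: sum.If_cases Pn Diff_eq Int_commute)
  ultimately show "(\<Sum>i\<in>J \<inter> Pp. x $ i) + (\<Sum>i\<in>J \<inter> Pn. \<bar>x $ i\<bar>)
      \<le> ?\<beta> * N (A *v x)
        + \<xi> * ((\<Sum>i\<in>Pn - J. \<bar>x $ i\<bar>) + (\<Sum>i\<in>Pp - J. max (- (x $ i)) (\<theta> * x $ i)))"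
    by simp
qed

section \<open>Exact recovery\<close>

text \<open>Dropping the negative entries in \<open>Pp\<close> from the support moves them to the penalty side, so
  the positive part of \<open>x\<close> is at most \<open>\<xi>\<close> times its negative part.\<close>

lemma SG_kernel_positive_part_le:
  fixes A :: "real^'n^'m"
  assumes SG: "SG Pp Pn N s \<beta> \<xi> \<theta> A" and "N 0 = 0" "0 \<le> \<theta>" "Pp \<union> Pn = UNIV" "Pp \<inter> Pn = {}"
    and x: "A *v x = 0" "\<And>i. i \<notin> J \<Longrightarrow> x $ i = 0" and J: "card J \<le> s"
  shows "(\<Sum>i\<in>Pp. max (x $ i) 0) + (\<Sum>i\<in>Pn. \<bar>x $ i\<bar>) \<le> \<xi> * (\<Sum>i\<in>Pp. max (- x $ i) 0)"
proof -
  \<comment> \<open>On \<open>K\<close> every entry with index in \<open>Pp\<close> is positive, so the linear sum in \<open>SG\<close> does not cancel.\<close>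
  define K where "K = J - {i \<in> Pp. x $ i \<le> 0}"
  have "card K \<le> s"
    using J card_mono[of J K] by (auto simp: K_def)
  then have "(\<Sum>i\<in>K \<inter> Pp. x $ i) + (\<Sum>i\<in>K \<inter> Pn. \<bar>x $ i\<bar>)
      \<le> \<xi> * ((\<Sum>i\<in>Pn - K. \<bar>x $ i\<bar>) + (\<Sum>i\<in>Pp - K. max (- (x $ i)) (\<theta> * x $ i)))"
    using SG[unfolded SG_def, rule_format, of K x] x(1) assms(2) by simp
  moreover have "(\<Sum>i\<in>K \<inter> Pp. x $ i) = (\<Sum>i\<in>Pp. max (x $ i) 0)"
    using x(2) by (intro sum.mono_neutral_cong_left) (force simp: K_def)+
  moreover have "(\<Sum>i\<in>K \<inter> Pn. \<bar>x $ i\<bar>) = (\<Sum>i\<in>Pn. \<bar>x $ i\<bar>)"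
    using x(2) assms(5) by (intro sum.mono_neutral_left) (auto simp: K_def)
  moreover have "(\<Sum>i\<in>Pn - K. \<bar>x $ i\<bar>) = 0"
    using x(2) assms(5) by (intro sum.neutral) (auto simp: K_def)
  moreover have "(\<Sum>i\<in>Pp - K. max (- (x $ i)) (\<theta> * x $ i)) = (\<Sum>i\<in>Pp. max (- x $ i) 0)"
  proof (intro sum.mono_neutral_cong_left)
    fix i assume "i \<in> Pp - K"
    then have "x $ i \<le> 0"
      using x(2)[of i] by (auto simp: K_def)
    then show "max (- (x $ i)) (\<theta> * x $ i) = max (- x $ i) 0"
      using mult_nonneg_nonpos[OF assms(3)] by (smt (verit))
  qed (auto simp: K_def)
  ultimately show ?thesis
    by simp
qed

text \<open>Since \<open>\<xi> < 1\<close>, the bounds of the positive part by the negative one and conversely, the latter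
  obtained from \<open>- x\<close>, leave no room for a nonzero vector.\<close>

lemma SG_sparse_kernel_eq_0:
  fixes A :: "real^'n^'m"
  assumes "SG Pp Pn N s \<beta> \<xi> \<theta> A" "N 0 = 0" "0 \<le> \<theta>" "Pp \<union> Pn = UNIV" "Pp \<inter> Pn = {}" "\<xi> < 1"
    and x: "A *v x = 0" "\<And>i. i \<notin> J \<Longrightarrow> x $ i = 0" and J: "card J \<le> s"
  shows "x = 0"
proof -
  let ?p = "\<Sum>i\<in>Pp. max (x $ i) 0" and ?m = "\<Sum>i\<in>Pp. max (- x $ i) 0"
    and ?n = "\<Sum>i\<in>Pn. \<bar>x $ i\<bar>"
  have "A *v (- x) = 0"
    using x(1) matrix_vector_mult_diff_distrib[of A 0 x] by simp
  then have "?m + ?n \<le> \<xi> * ?p"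
    using SG_kernel_positive_part_le[OF assms(1-5), of "- x" J] x(2) J by simp
  moreover have "?p + ?n \<le> \<xi> * ?m"
    using SG_kernel_positive_part_le[OF assms(1-5) x J] .
  ultimately have "(1 - \<xi>) * (?p + ?m) + 2 * ?n \<le> 0"
    by (simp add: algebra_simps)
  moreover have nn: "0 \<le> ?p" "0 \<le> ?m" "0 \<le> ?n"
    by (auto intro: sum_nonneg)
  moreover from nn have "0 \<le> (1 - \<xi>) * (?p + ?m)"
    using assms(6) by simp
  ultimately have "(1 - \<xi>) * (?p + ?m) = 0" "?n = 0"
    by linarith+
  then have "?p = 0" "?m = 0" "?n = 0"
    using assms(6) nn by auto
  then have "\<forall>i\<in>Pp. max (x $ i) 0 = 0" "\<forall>i\<in>Pp. max (- x $ i) 0 = 0" "\<forall>i\<in>Pn. \<bar>x $ i\<bar> = 0"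
    by (simp_all add: sum_nonneg_eq_0_iff)
  then have "x $ i = 0" for i
    using assms(4) by (cases "i \<in> Pp") (force simp: max_def split: if_splits)+
  then show ?thesis
    by (simp add: vec_eq_iff)
qed

text \<open>Feasibility makes \<open>w - z\<close> nonpositive on \<open>Pp\<close> off the support of \<open>w\<close>, where the penalty
  therefore equals \<open>\<bar>z $ i\<bar>\<close>.  The mass of \<open>z\<close> off the support thus costs more than what it saves
  on the support.\<close>

lemma SG_feasible_eq:
  fixes A :: "real^'n^'m"
  assumes SG: "SG Pp Pn N s \<beta> \<xi> \<theta> A" and "N 0 = 0" "0 \<le> \<theta>" "Pp \<union> Pn = UNIV" "Pp \<inter> Pn = {}" "\<xi> < 1"
    and w: "card {i. w $ i \<noteq> 0} \<le> s" "\<And>i. i \<in> Pp \<Longrightarrow> 0 \<le> w $ i"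
    and z: "A *v z = A *v w" "\<And>i. i \<in> Pp \<Longrightarrow> 0 \<le> z $ i" "l1_norm z \<le> l1_norm w"
  shows "z = w"
proof -
  define J where "J = {i. w $ i \<noteq> 0}"
  have Pn: "Pn = - Pp"
    using assms(4,5) by blast
  have ker: "A *v (w - z) = 0"
    using z(1) by (simp add: matrix_vector_mult_diff_distrib)
  have w0: "w $ i = 0" if "i \<notin> J" for i
    using that by (simp add: J_def)
  have split: "(\<Sum>i\<in>UNIV. f i) = (\<Sum>i\<in>J. f i) + (\<Sum>i\<in>-J. f i)" for f :: "'n \<Rightarrow> real"
    by (simp add: sum.subset_diff[of J UNIV] Compl_eq_Diff_UNIV)
  have SGx: "(\<Sum>i\<in>J \<inter> Pp. (w - z) $ i) + (\<Sum>i\<in>J \<inter> Pn. \<bar>(w - z) $ i\<bar>)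
      \<le> \<xi> * ((\<Sum>i\<in>Pn - J. \<bar>(w - z) $ i\<bar>)
            + (\<Sum>i\<in>Pp - J. max (- ((w - z) $ i)) (\<theta> * (w - z) $ i)))"
    using SG[unfolded SG_def, rule_format, of J "w - z"] ker assms(2) w(1)
    by (simp add: J_def del: vector_minus_component)
  have "(\<Sum>i\<in>Pp - J. max (- ((w - z) $ i)) (\<theta> * (w - z) $ i)) = (\<Sum>i\<in>Pp - J. \<bar>z $ i\<bar>)"
  proof (rule sum.cong)
    fix i assume "i \<in> Pp - J"
    then have "0 \<le> z $ i" "w $ i = 0"
      using z(2) w0 by auto
    then show "max (- ((w - z) $ i)) (\<theta> * (w - z) $ i) = \<bar>z $ i\<bar>"
      using mult_nonneg_nonneg[OF assms(3), of "z $ i"] by simp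
  qed simp
  moreover have "(\<Sum>i\<in>Pn - J. \<bar>(w - z) $ i\<bar>) = (\<Sum>i\<in>Pn - J. \<bar>z $ i\<bar>)"
    using w0 by (intro sum.cong) auto
  moreover have "(\<Sum>i\<in>-J. \<bar>z $ i\<bar>) = (\<Sum>i\<in>Pn - J. \<bar>z $ i\<bar>) + (\<Sum>i\<in>Pp - J. \<bar>z $ i\<bar>)"
    using assms(4,5) by (subst sum.union_disjoint[symmetric]) (auto intro: sum.cong)
  moreover have "(\<Sum>i\<in>J. \<bar>w $ i\<bar> - \<bar>z $ i\<bar>)
      \<le> (\<Sum>i\<in>J \<inter> Pp. (w - z) $ i) + (\<Sum>i\<in>J \<inter> Pn. \<bar>(w - z) $ i\<bar>)"
  proof -
    have "(\<Sum>i\<in>J. \<bar>w $ i\<bar> - \<bar>z $ i\<bar>)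
        \<le> (\<Sum>i\<in>J. if i \<in> Pp then (w - z) $ i else \<bar>(w - z) $ i\<bar>)"
      using w(2) z(2) by (intro sum_mono) auto
    then show ?thesis
      by (simp add: sum.If_cases Pn)
  qed
  ultimately have "(\<Sum>i\<in>J. \<bar>w $ i\<bar>) - (\<Sum>i\<in>J. \<bar>z $ i\<bar>) \<le> \<xi> * (\<Sum>i\<in>-J. \<bar>z $ i\<bar>)"
    using SGx by (simp add: sum_subtractf)
  moreover have "(\<Sum>i\<in>J. \<bar>z $ i\<bar>) + (\<Sum>i\<in>-J. \<bar>z $ i\<bar>) \<le> (\<Sum>i\<in>J. \<bar>w $ i\<bar>)"
    using z(3) w0 by (simp add: l1_norm_def split)
  ultimately have "(1 - \<xi>) * (\<Sum>i\<in>-J. \<bar>z $ i\<bar>) \<le> 0"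
    by (simp add: algebra_simps)
  moreover have "0 \<le> (\<Sum>i\<in>-J. \<bar>z $ i\<bar>)"
    by (simp add: sum_nonneg)
  ultimately have "(\<Sum>i\<in>-J. \<bar>z $ i\<bar>) = 0"
    using assms(6) by (simp add: mult_le_0_iff)
  then have z0: "z $ i = 0" if "i \<notin> J" for i
    using that by (simp add: sum_nonneg_eq_0_iff)
  have "w - z = 0"
  proof (rule SG_sparse_kernel_eq_0[OF assms(1-6) ker])
    show "(w - z) $ i = 0" if "i \<notin> J" for i
      using w0[OF that] z0[OF that] by simp
    show "card J \<le> s"
      using w(1) by (simp add: J_def)
  qed
  then show ?thesis
    by simp
qed

lemma SG_imp_semigood:
  fixes A :: "real^'n^'m"
  assumes "SG Pp Pn N s \<beta> \<xi> \<theta> A" "N 0 = 0" "0 \<le> \<theta>" "Pp \<union> Pn = UNIV" "Pp \<inter> Pn = {}" "\<xi> < 1"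
  shows "semigood Pp s A"
  unfolding semigood_def
proof (intro allI impI)
  fix w z :: "real^'n"
  assume w: "card {i. w $ i \<noteq> 0} \<le> s \<and> (\<forall>i\<in>Pp. 0 \<le> w $ i)"
  have eq: "y = w" if "A *v y = A *v w" "\<forall>i\<in>Pp. 0 \<le> y $ i" "l1_norm y \<le> l1_norm w" for y
    using w that by (intro SG_feasible_eq[OF assms]) auto
  show "is_arg_min l1_norm (\<lambda>z. A *v z = A *v w \<and> (\<forall>i\<in>Pp. 0 \<le> z $ i)) z \<longleftrightarrow> z = w"
    using w eq unfolding is_arg_min_def by (metis less_imp_le less_irrefl not_less)
qed

theorem proposition4p1:
  fixes A :: "real^'n^'m"
    and s :: nat
    and Pp Pn :: "'n set"
    and N :: "real^'m \<Rightarrow> real"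
    and \<xi> \<theta> \<rho> \<sigma> :: real
  assumes "1 \<le> s" and "s \<le> CARD('m)"
    and "Pp \<union> Pn = UNIV" and "Pp \<inter> Pn = {}"
    and "is_norm N"
    and "0 \<le> \<xi>" and "\<xi> < 1" and "1 \<le> \<theta>" and "0 \<le> \<rho>" and "0 \<le> \<sigma>"
    and "VSG Pp N s \<xi> \<theta> \<rho> \<sigma> A"
  shows "(let \<beta> = \<rho> + \<sigma> * Max {real kp * (1 + \<theta> * \<xi>) + real kn * (1 + \<xi>) | kp kn.
                              kp \<le> card Pp \<and> kn \<le> card Pn \<and> kp + kn \<le> s}
          in SG Pp Pn N s \<beta> \<xi> \<theta> A \<and> \<beta> \<le> \<rho> + \<sigma> * real s * (1 + \<theta> * \<xi>))
         \<and> semigood Pp s A"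
proof -
  let ?W = "Max {real kp * (1 + \<theta> * \<xi>) + real kn * (1 + \<xi>) | kp kn.
                   kp \<le> card Pp \<and> kn \<le> card Pn \<and> kp + kn \<le> s}"
  have SG: "SG Pp Pn N s (\<rho> + \<sigma> * ?W) \<xi> \<theta> A"
    using assms by (intro VSG_imp_SG) auto
  have "\<xi> \<le> \<theta> * \<xi>"
    using mult_right_mono[OF assms(8,6)] by simp
  then have "?W \<le> real s * (1 + \<theta> * \<xi>)"
    using assms(6) by (intro Max_index_weights_le) auto
  then have "\<sigma> * ?W \<le> \<sigma> * (real s * (1 + \<theta> * \<xi>))"
    using assms(10) by (rule mult_left_mono)
  moreover have "N 0 = 0"
    using assms(5) by (rule is_norm_zero)
  then have "semigood Pp s A"
    using SG assms by (intro SG_imp_semigood[OF SG]) auto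
  ultimately show ?thesis
    using SG by (simp add: Let_def mult.assoc)
qed

end
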